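(* Let $U\subset\mathbb{R}^V$ be a linear space of graph signals, and set $\mathbf{T}=a_1\mathbf{S}_1+\cdots+a_d\mathbf{S}_d$, where the real coefficients $a_1,\ldots,a_d$ are selected so that the numbers $\mu(m):=\sum_{l=1}^d a_l\gamma_l(m)$, $1\le m\le M$, are distinct. Then the following statements are equivalent: (i) The linear space $U$ is shift-invariant. (ii) The linear space $U$ is the graph shift-invariant space $\mathcal{S}(\Phi)$ generated by some finite family $\Phi$ of graph signals. (iii) The linear space $U$ is the graph shift-invariant space generated by some finite family $\Phi$ of graph signals with respect to the graph shift $\mathbf{T}$, i.e., $U=\mathrm{span}\{\mathbf{T}^k\phi : 0\le k\le M-1,\ \phi\in\Phi\}$.
   Context: Let $\mathcal{G}=(V,E,\mathbf{W})$ be a finite, simple, undirected graph with $N\ge 2$ vertices. A graph signal is a vector in $\mathbb{R}^V$. A graph shift is a matrix $\mathbf{S}=[s(i,j)]_{i,j\in V}$ with $s(i,j)=0$ unless $i=j$ or $(i,j)\in E$. Standing assumption: $\mathbf{S}_1,\ldots,\mathbf{S}_d$ are graph shifts that are real-valued, symmetric and pairwise commuting. Choose an orthogonal matrix $\mathbf{U}=[\mathbf{u}_1,\ldots,\mathbf{u}_N]$ with $\mathbf{S}_l=\sum_{n=1}^N\lambda_l(n)\mathbf{u}_n\mathbf{u}_n^T$ for $1\le l\le d$, and set $\boldsymbol{\lambda}(n)=[\lambda_1(n),\ldots,\lambda_d(n)]^T\in\mathbb{R}^d$. Let $\boldsymbol{\gamma}(m)=[\gamma_1(m),\ldots,\gamma_d(m)]^T$,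 $1\le m\le M$, be the distinct elements of $\{\boldsymbol{\lambda}(n): 1\le n\le N\}$. A linear space $U$ of graph signals is shift-invariant (a graph shift-invariant space) if $\mathbf{S}_l\mathbf{x}\in U$ for all $1\le l\le d$ and $\mathbf{x}\in U$. For a family $\Phi$ of graph signals, $\mathcal{S}(\Phi)=\mathrm{span}\{\mathbf{S}_1^{\alpha_1}\cdots\mathbf{S}_d^{\alpha_d}\phi : \alpha_1,\ldots,\alpha_d\in\mathbb{Z}_+,\ \phi\in\Phi\}$, where $\mathbb{Z}_+$ denotes the nonnegative integers. *)

theory Defs
  imports "HOL-Analysis.Analysis"
begin

text \<open>
  The vertex set of a graph is the finite type \<open>'v\<close>, so graph signals are elements of
  \<open>real ^ 'v\<close> and graph shifts are elements of \<open>real ^ 'v ^ 'v\<close>. An undirected edge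
  between \<open>i\<close> and \<open>j\<close> is represented by both pairs \<open>(i, j)\<close> and \<open>(j, i)\<close>.
\<close>

definition simple_graph :: "('v \<times> 'v) set \<Rightarrow> bool" where
  "simple_graph E \<longleftrightarrow> sym E \<and> irrefl E"

definition graph_shift :: "('v \<times> 'v) set \<Rightarrow> real ^ 'v ^ 'v::finite \<Rightarrow> bool" where
  "graph_shift E A \<longleftrightarrow> (\<forall>i j. \<not> (i = j \<or> (i, j) \<in> E) \<longrightarrow> A $ i $ j = 0)"

text \<open>
  Powers and products of matrices have to be taken with respect to \<open>**\<close>: the operations
  \<open>*\<close> and \<open>^\<close> on \<open>real ^ 'v ^ 'v\<close> act entrywise.
\<close>

definition mat_power :: "real ^ 'v ^ 'v::finite \<Rightarrow> nat \<Rightarrow> real ^ 'v ^ 'v" where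
  "mat_power A k = (((**) A) ^^ k) (mat 1)"

definition outer_square :: "real ^ 'v::finite \<Rightarrow> real ^ 'v ^ 'v" where
  "outer_square u = (\<chi> i j. u $ i * u $ j)"

text \<open>
  The shifts are indexed by a finite linearly ordered type \<open>'d\<close> in place of \<open>1, \<dots>, d\<close>;
  the order serves only to make sense of the product of the powers of the individual shifts,
  with factors arranged from left to right by increasing index.
\<close>

definition shift_monomial ::
    "('d::{finite, linorder} \<Rightarrow> real ^ 'v ^ 'v::finite) \<Rightarrow> ('d \<Rightarrow> nat) \<Rightarrow> real ^ 'v ^ 'v" where
  "shift_monomial S \<alpha> =
     foldr (\<lambda>l A. mat_power (S l) (\<alpha> l) ** A) (sorted_list_of_set UNIV) (mat 1)"

definition shift_invariant ::
    "('d \<Rightarrow> real ^ 'v ^ 'v::finite) \<Rightarrow> (real ^ 'v) set \<Rightarrow> bool" where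
  "shift_invariant S U \<longleftrightarrow> subspace U \<and> (\<forall>l. \<forall>x\<in>U. S l *v x \<in> U)"

definition generated_space ::
    "('d::{finite, linorder} \<Rightarrow> real ^ 'v ^ 'v::finite) \<Rightarrow> (real ^ 'v) set \<Rightarrow> (real ^ 'v) set" where
  "generated_space S \<Phi> = span {shift_monomial S \<alpha> *v \<phi> | \<alpha> \<phi>. \<phi> \<in> \<Phi>}"

end

theory Submission
  imports Defs
begin

text \<open>
  The shifts are simultaneously diagonalized by \<open>Q\<close>, so every matrix that occurs is determined
  by its eigenvalues, a function of the index of the eigenvector. Since the \<open>\<mu> m\<close> are distinct,
  each joint eigenvalue \<open>lam n\<close> is a function of the eigenvalue of \<open>T\<close> at \<open>n\<close>, and
  interpolation at the \<open>M\<close> points \<open>\<mu> m\<close> writes \<open>S l T\<^sup>k\<close> as a polynomial in \<open>T\<close> of degree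
  at most \<open>M - 1\<close>. Hence the spans in (ii) and (iii) are shift-invariant; conversely, a
  shift-invariant space is generated by any of its bases.
\<close>

section \<open>Interpolation and generators of invariant subspaces\<close>

text \<open>Newton's scheme: a new node \<open>y\<close> is met by adding to \<open>p\<close> a
  multiple of the polynomial \<open>w\<close> that vanishes exactly on \<open>X\<close>, so the
  values at the old nodes survive and the factor can be chosen to correct the value at
  \<open>y\<close>.\<close>

lemma polynomial_interpolation:
  fixes h :: "'a::field \<Rightarrow> 'a"
  assumes "finite X"
  shows "\<exists>p. degree p \<le> card X - 1 \<and> (\<forall>x\<in>X. poly p x = h x)"
  using assms
proof (induction X rule: finite_induct)
  case empty
  show ?case by (intro exI[of _ 0]) simp
next
  case (insert y X)
  then obtain p where p: "degree p \<le> card X - 1" "\<And>x. x \<in> X \<Longrightarrow> poly p x = h x"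
    by blast
  define w where "w = (\<Prod>x\<in>X. [:- x, 1:])"
  have w_eq: "poly w z = (\<Prod>x\<in>X. z - x)" for z
    by (simp add: w_def poly_prod)
  have wy: "poly w y \<noteq> 0"
    using insert.hyps by (auto simp: w_eq)
  have wX: "poly w x = 0" if "x \<in> X" for x
    using insert.hyps that by (auto simp: w_eq)
  have "degree w \<le> card X"
    using degree_prod_sum_le[OF insert.hyps(1), of "\<lambda>x. [:- x, 1:]"] by (simp add: w_def)
  moreover define q where "q = p + smult ((h y - poly p y) / poly w y) w"
  \<comment> \<open>This is the required bound, since \<open>y\<close> is a new node and
    \<open>card (insert y X) - 1 = card X\<close>.\<close>
  ultimately have "degree q \<le> card X"
    using p(1) by (auto simp: q_def intro!: degree_add_le degree_smult_le[THEN order_trans])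
  moreover have "\<forall>x\<in>insert y X. poly q x = h x"
    using p(2) wy wX by (auto simp: q_def)
  ultimately show ?case
    using insert.hyps by (intro exI[of _ q]) auto
qed

lemma linear_span_invariant:
  fixes f :: "'a::real_vector \<Rightarrow> 'a"
  assumes "x \<in> span B" "linear f" "\<And>b. b \<in> B \<Longrightarrow> f b \<in> span B"
  shows "f x \<in> span B"
proof -
  have "f ` span B = span (f ` B)"
    using linear_span_image[OF assms(2)] by simp
  also have "\<dots> \<subseteq> span B"
    using assms(3) by (intro span_minimal) auto
  finally show ?thesis
    using assms(1) by auto
qed

text \<open>A basis of \<open>U\<close> serves as generating family: it lies among the generators
  because \<open>mat 1\<close> is in \<open>F\<close>, and invariance keeps every generator in
  \<open>U\<close>. The set \<open>F\<close> is left abstract to cover both the shift monomials and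
  the bounded powers of a single matrix.\<close>

lemma invariant_subspace_finitely_generated:
  fixes U :: "(real ^ 'v::finite) set"
  assumes U: "subspace U" and I: "mat 1 \<in> F"
    and inv: "\<And>A x. A \<in> F \<Longrightarrow> x \<in> U \<Longrightarrow> A *v x \<in> U"
  shows "\<exists>\<Phi>. finite \<Phi> \<and> U = span {A *v \<phi> | A \<phi>. A \<in> F \<and> \<phi> \<in> \<Phi>}"
proof -
  obtain B where B: "B \<subseteq> U" "independent B" "U \<subseteq> span B"
    using basis_exists by metis
  let ?G = "{A *v \<phi> | A \<phi>. A \<in> F \<and> \<phi> \<in> B}"
  have "B \<subseteq> ?G"
    using I by (force intro: exI[of _ "mat 1"])
  then have "U \<subseteq> span ?G"
    using B(3) span_mono by blast
  moreover have "span ?G \<subseteq> U"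
    using B(1) inv U by (intro span_minimal) auto
  ultimately show ?thesis
    using B(2) by (auto intro: independent_imp_finite)
qed

section \<open>Calculus of simultaneously diagonalized matrices\<close>

text \<open>This is Q diag(f) Q^T. For orthogonal \<open>Q\<close>, products of such matrices become
  pointwise products of eigenvalue functions.\<close>

definition spectral_matrix :: "real ^ 'v ^ 'v \<Rightarrow> ('v \<Rightarrow> real) \<Rightarrow> real ^ 'v ^ 'v::finite" where
  "spectral_matrix Q f = (\<Sum>n\<in>UNIV. f n *\<^sub>R outer_square (column n Q))"

lemma spectral_matrix_nth:
  "spectral_matrix Q f $ i $ j = (\<Sum>n\<in>UNIV. f n * (Q $ i $ n * Q $ j $ n))"
  by (simp add: spectral_matrix_def outer_square_def column_def)

text \<open>Linearity in the eigenvalue function. It serves twice: to diagonalize \<open>T\<close>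
  from the shifts, and to turn a polynomial in the eigenvalues into the same polynomial in the
  matrix.\<close>

lemma spectral_matrix_sum:
  "spectral_matrix Q (\<lambda>n. \<Sum>k\<in>K. c k * g k n) = (\<Sum>k\<in>K. c k *\<^sub>R spectral_matrix Q (g k))"
proof -
  have "(\<Sum>n\<in>UNIV. (\<Sum>k\<in>K. c k * g k n) *\<^sub>R outer_square (column n Q))
      = (\<Sum>n\<in>UNIV. \<Sum>k\<in>K. c k *\<^sub>R (g k n *\<^sub>R outer_square (column n Q)))"
    by (simp add: scaleR_sum_left)
  also have "\<dots> = (\<Sum>k\<in>K. \<Sum>n\<in>UNIV. c k *\<^sub>R (g k n *\<^sub>R outer_square (column n Q)))"
    by (rule sum.swap)
  finally show ?thesis
    by (simp only: spectral_matrix_def scaleR_sum_right)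
qed

lemma orthogonal_matrix_columns:
  assumes "orthogonal_matrix Q"
  shows "(\<Sum>k\<in>UNIV. Q $ k $ n * Q $ k $ m) = (if n = m then 1 else 0)"
proof -
  have "(transpose Q ** Q) $ n $ m = mat 1 $ n $ m"
    using assms by (simp add: orthogonal_matrix_def)
  then show ?thesis
    by (simp add: matrix_matrix_mult_def transpose_def mat_def)
qed

lemma spectral_matrix_one:
  assumes "orthogonal_matrix Q"
  shows "spectral_matrix Q (\<lambda>n. 1) = mat 1"
proof -
  have "spectral_matrix Q (\<lambda>n. 1) = Q ** transpose Q"
    by (simp add: vec_eq_iff spectral_matrix_nth matrix_matrix_mult_def transpose_def)
  then show ?thesis
    using assms by (simp add: orthogonal_matrix_def)
qed

text \<open>Moving the sum over \<open>k\<close> innermost isolates the inner products of the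
  columns of \<open>Q\<close>; orthonormality keeps only the terms with
  \<open>n = m\<close>.\<close>

lemma spectral_matrix_mult:
  assumes "orthogonal_matrix Q"
  shows "spectral_matrix Q f ** spectral_matrix Q g = spectral_matrix Q (\<lambda>n. f n * g n)"
proof -
  have "(\<Sum>k\<in>UNIV. spectral_matrix Q f $ i $ k * spectral_matrix Q g $ k $ j)
      = spectral_matrix Q (\<lambda>n. f n * g n) $ i $ j" for i j
  proof -
    have "(\<Sum>k\<in>UNIV. spectral_matrix Q f $ i $ k * spectral_matrix Q g $ k $ j)
        = (\<Sum>k\<in>UNIV. \<Sum>n\<in>UNIV. \<Sum>m\<in>UNIV.
            f n * Q $ i $ n * g m * Q $ j $ m * (Q $ k $ n * Q $ k $ m))"
      by (simp add: spectral_matrix_nth sum_product mult_ac)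
    also have "\<dots> = (\<Sum>n\<in>UNIV. \<Sum>m\<in>UNIV.
            f n * Q $ i $ n * g m * Q $ j $ m * (\<Sum>k\<in>UNIV. Q $ k $ n * Q $ k $ m))"
      unfolding sum_distrib_left
      by (rule trans[OF sum.swap]) (intro sum.cong refl sum.swap)
    also have "\<dots> = (\<Sum>n\<in>UNIV. f n * Q $ i $ n * g n * Q $ j $ n)"
      by (simp add: orthogonal_matrix_columns[OF assms] if_distrib cong: if_cong)
    finally show ?thesis
      by (simp add: spectral_matrix_nth mult_ac)
  qed
  then show ?thesis
    by (simp add: vec_eq_iff matrix_matrix_mult_def)
qed

lemma mat_power_spectral:
  assumes "orthogonal_matrix Q"
  shows "mat_power (spectral_matrix Q f) k = spectral_matrix Q (\<lambda>n. f n ^ k)"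
  by (induction k)
    (simp_all add: mat_power_def spectral_matrix_one[OF assms] spectral_matrix_mult[OF assms])

lemma shift_monomial_spectral:
  assumes Q: "orthogonal_matrix Q" and S: "\<And>l. S l = spectral_matrix Q (f l)"
  shows "shift_monomial S \<alpha> = spectral_matrix Q (\<lambda>n. \<Prod>l\<in>UNIV. f l n ^ \<alpha> l)"
proof -
  have "foldr (\<lambda>l A. mat_power (S l) (\<alpha> l) ** A) xs (mat 1)
      = spectral_matrix Q (\<lambda>n. \<Prod>l\<leftarrow>xs. f l n ^ \<alpha> l)" for xs
    by (induction xs)
      (simp_all add: S mat_power_spectral[OF Q] spectral_matrix_one[OF Q]
        spectral_matrix_mult[OF Q])
  \<comment> \<open>The sorted list of all indices is distinct, so the product along it is the
    product over \<open>UNIV\<close>.\<close>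
  then show ?thesis
    by (simp add: shift_monomial_def prod.distinct_set_conv_list[symmetric])
qed

section \<open>Generated spaces and their invariance\<close>

lemma mat_power_invariant:
  assumes "\<And>x. x \<in> U \<Longrightarrow> A *v x \<in> U" "x \<in> U"
  shows "mat_power A k *v x \<in> U"
  using assms(2)
  by (induction k) (simp_all add: mat_power_def assms(1) matrix_vector_mul_assoc[symmetric])

lemma shift_monomial_invariant:
  assumes "shift_invariant S U" "x \<in> U"
  shows "shift_monomial S \<alpha> *v x \<in> U"
proof -
  have "foldr (\<lambda>l A. mat_power (S l) (\<alpha> l) ** A) xs (mat 1) *v x \<in> U" for xs
    using assms
    by (induction xs)
      (simp_all add: shift_invariant_def mat_power_invariant matrix_vector_mul_assoc[symmetric])
  then show ?thesis
    by (simp add: shift_monomial_def)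
qed

text \<open>The factor \<open>S l\<close> has to move past the shifts that precede index
  \<open>l\<close>. Comparing eigenvalues does this at once, as real multiplication
  commutes.\<close>

lemma shift_mult_monomial:
  assumes Q: "orthogonal_matrix Q" and S: "\<And>l. S l = spectral_matrix Q (f l)"
  shows "S l ** shift_monomial S \<alpha> = shift_monomial S (\<alpha>(l := Suc (\<alpha> l)))"
proof -
  have "f l n * (\<Prod>k\<in>UNIV. f k n ^ \<alpha> k) = (\<Prod>k\<in>UNIV. f k n ^ (\<alpha>(l := Suc (\<alpha> l))) k)" for n
    by (simp add: prod.remove[of UNIV l])
  then show ?thesis
    unfolding shift_monomial_spectral[OF Q S] S spectral_matrix_mult[OF Q] by simp
qed

lemma shift_invariant_generated_space:
  assumes Q: "orthogonal_matrix Q" and S: "\<And>l. S l = spectral_matrix Q (f l)"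
  shows "shift_invariant S (generated_space S \<Phi>)"
  unfolding shift_invariant_def
proof (intro conjI allI ballI)
  show "subspace (generated_space S \<Phi>)"
    by (simp add: generated_space_def)
next
  fix l x
  assume "x \<in> generated_space S \<Phi>"
  then show "S l *v x \<in> generated_space S \<Phi>"
    unfolding generated_space_def
  proof (rule linear_span_invariant[OF _ matrix_vector_mul_linear])
    fix b
    assume "b \<in> {shift_monomial S \<alpha> *v \<phi> | \<alpha> \<phi>. \<phi> \<in> \<Phi>}"
    then obtain \<alpha> \<phi> where b: "b = shift_monomial S \<alpha> *v \<phi>" "\<phi> \<in> \<Phi>"
      by blast
    have "S l *v b = shift_monomial S (\<alpha>(l := Suc (\<alpha> l))) *v \<phi>"
      unfolding b(1) matrix_vector_mul_assoc
      by (simp only: shift_mult_monomial[where S = S and f = f, OF Q S])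
    with b(2) show "S l *v b \<in> span {shift_monomial S \<alpha> *v \<phi> | \<alpha> \<phi>. \<phi> \<in> \<Phi>}"
      by (intro span_base) blast
  qed
qed

lemma shift_invariant_imp_generated:
  assumes "shift_invariant S U"
  shows "\<exists>\<Phi>. finite \<Phi> \<and> U = generated_space S \<Phi>"
proof -
  have "shift_monomial S (\<lambda>l. 0) = mat 1"
  proof -
    have "foldr (\<lambda>l A. mat_power (S l) 0 ** A) xs (mat 1) = mat 1" for xs
      by (induction xs) (simp_all add: mat_power_def)
    then show ?thesis
      by (simp add: shift_monomial_def)
  qed
  then have I: "mat 1 \<in> range (shift_monomial S)"
    by (metis rangeI)
  have U: "subspace U"
    using assms by (simp add: shift_invariant_def)
  have "A *v x \<in> U" if "A \<in> range (shift_monomial S)" "x \<in> U" for A x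
    using that shift_monomial_invariant[OF assms] by blast
  from invariant_subspace_finitely_generated[OF U I this]
  obtain \<Phi> where "finite \<Phi>"
    "U = span {A *v \<phi> | A \<phi>. A \<in> range (shift_monomial S) \<and> \<phi> \<in> \<Phi>}"
    by auto
  moreover have "{A *v \<phi> | A \<phi>. A \<in> range (shift_monomial S) \<and> \<phi> \<in> \<Phi>}
      = {shift_monomial S \<alpha> *v \<phi> | \<alpha> \<phi>. \<phi> \<in> \<Phi>}"
    by blast
  ultimately show ?thesis
    by (auto simp: generated_space_def)
qed

text \<open>The zeroth power is \<open>mat 1\<close> and lies within any bound \<open>K\<close>, so
  a basis of \<open>U\<close> again generates.\<close>

lemma invariant_imp_generated_powers:
  assumes U: "subspace U" and inv: "\<And>x. x \<in> U \<Longrightarrow> T *v x \<in> U"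
  shows "\<exists>\<Phi>. finite \<Phi> \<and> U = span {mat_power T k *v \<phi> | k \<phi>. k \<in> {0..K} \<and> \<phi> \<in> \<Phi>}"
proof -
  have "mat 1 \<in> mat_power T ` {0..K}"
    by (rule image_eqI[of _ _ 0]) (simp_all add: mat_power_def)
  from invariant_subspace_finitely_generated[OF U this]
  obtain \<Phi> where "finite \<Phi>" "U = span {A *v \<phi> | A \<phi>. A \<in> mat_power T ` {0..K} \<and> \<phi> \<in> \<Phi>}"
    using mat_power_invariant[OF inv] by auto
  moreover have "{A *v \<phi> | A \<phi>. A \<in> mat_power T ` {0..K} \<and> \<phi> \<in> \<Phi>}
      = {mat_power T k *v \<phi> | k \<phi>. k \<in> {0..K} \<and> \<phi> \<in> \<Phi>}"
    by blast
  ultimately show ?thesis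
    by auto
qed

section \<open>Reduction to polynomials in one matrix\<close>

text \<open>The assumption on \<open>g\<close> says that it factors through \<open>\<nu>\<close>.
  Interpolating \<open>h\<close> on the distinct values of \<open>\<nu>\<close> gives a polynomial,
  and its coefficients are the \<open>c k\<close>.\<close>

lemma spectral_matrix_eq_polynomial:
  assumes Q: "orthogonal_matrix Q" and g: "\<And>n. g n = h (\<nu> n)"
  obtains c where "spectral_matrix Q g
    = (\<Sum>k\<in>{0..card (range \<nu>) - 1}. c k *\<^sub>R mat_power (spectral_matrix Q \<nu>) k)"
proof -
  obtain p where p: "degree p \<le> card (range \<nu>) - 1" "\<And>n. poly p (\<nu> n) = h (\<nu> n)"
    using polynomial_interpolation[of "range \<nu>" h] by auto
  have "g n = (\<Sum>k\<in>{0..card (range \<nu>) - 1}. coeff p k * \<nu> n ^ k)" for n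
  proof -
    have "g n = (\<Sum>k\<le>degree p. coeff p k * \<nu> n ^ k)"
      using p(2) g by (simp flip: poly_altdef)
    \<comment> \<open>Coefficients above the degree of \<open>p\<close> vanish, so the sum extends
      to the fixed bound.\<close>
    also have "\<dots> = (\<Sum>k\<in>{0..card (range \<nu>) - 1}. coeff p k * \<nu> n ^ k)"
      using p(1) by (intro sum.mono_neutral_left) (auto simp: coeff_eq_0)
    finally show ?thesis .
  qed
  then have "g = (\<lambda>n. \<Sum>k\<in>{0..card (range \<nu>) - 1}. coeff p k * \<nu> n ^ k)"
    by blast
  then have "spectral_matrix Q g
    = (\<Sum>k\<in>{0..card (range \<nu>) - 1}. coeff p k *\<^sub>R mat_power (spectral_matrix Q \<nu>) k)"
    by (simp only: spectral_matrix_sum mat_power_spectral[OF Q])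
  with that show thesis by blast
qed

lemma matrix_vector_mult_sum_scaleR:
  fixes A :: "'k \<Rightarrow> real ^ 'n ^ 'm"
  shows "(\<Sum>k\<in>K. c k *\<^sub>R A k) *v x = (\<Sum>k\<in>K. c k *\<^sub>R (A k *v x))"
  by (induction K rule: infinite_finite_induct)
    (simp_all add: matrix_vector_mult_add_rdistrib scaleR_matrix_vector_assoc)

theorem theorem4p2:
  fixes E :: "('v::finite \<times> 'v) set"
    and S :: "'d::{finite, linorder} \<Rightarrow> real ^ 'v ^ 'v"
    and Q :: "real ^ 'v ^ 'v"
    and lam :: "'v \<Rightarrow> real ^ 'd::{finite, linorder}"
    and M :: nat
    and \<gamma> :: "nat \<Rightarrow> real ^ 'd::{finite, linorder}"
    and a :: "'d::{finite, linorder} \<Rightarrow> real"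
    and \<mu> :: "nat \<Rightarrow> real"
    and T :: "real ^ 'v ^ 'v"
    and U :: "(real ^ 'v) set"
  assumes "CARD('v) \<ge> 2"
    and "simple_graph E"
    and "\<And>l. graph_shift E (S l)"
    and "\<And>l. transpose (S l) = S l"
    and "\<And>l k. S l ** S k = S k ** S l"
    and "orthogonal_matrix Q"
    and "\<And>l. S l = (\<Sum>n\<in>UNIV. (lam n $ l) *\<^sub>R outer_square (column n Q))"
    and "bij_betw \<gamma> {1..M} (range lam)"
    and "\<And>m. \<mu> m = (\<Sum>l\<in>UNIV. a l * \<gamma> m $ l)"
    and "inj_on \<mu> {1..M}"
    and "T = (\<Sum>l\<in>UNIV. a l *\<^sub>R S l)"
    and "subspace U"
  shows "(shift_invariant S U \<longleftrightarrow> (\<exists>\<Phi>. finite \<Phi> \<and> U = generated_space S \<Phi>)) \<and>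
         ((\<exists>\<Phi>. finite \<Phi> \<and> U = generated_space S \<Phi>) \<longleftrightarrow>
          (\<exists>\<Phi>. finite \<Phi> \<and> U = span {mat_power T k *v \<phi> | k \<phi>. k \<in> {0..M - 1} \<and> \<phi> \<in> \<Phi>}))"
proof -
  define f where "f l n = lam n $ l" for l n
  define \<nu> where "\<nu> n = (\<Sum>l\<in>UNIV. a l * f l n)" for n
  note Q = assms(6)
  have S: "S l = spectral_matrix Q (f l)" for l
    using assms(7) by (simp add: spectral_matrix_def f_def)
  have T: "T = spectral_matrix Q \<nu>"
    unfolding \<nu>_def spectral_matrix_sum assms(11) S ..
  have \<gamma>_index: "\<exists>m\<in>{1..M}. \<gamma> m = lam n \<and> \<mu> m = \<nu> n" for n
  proof -
    have "lam n \<in> \<gamma> ` {1..M}"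
      using assms(8) by (simp add: bij_betw_def)
    then show ?thesis
      by (auto simp: assms(9) \<nu>_def f_def)
  qed
  have range_\<nu>: "range \<nu> = \<mu> ` {1..M}"
  proof
    show "range \<nu> \<subseteq> \<mu> ` {1..M}"
      using \<gamma>_index by (metis image_eqI image_subsetI)
  next
    have "\<mu> m \<in> range \<nu>" if "m \<in> {1..M}" for m
    proof -
      have "\<gamma> m \<in> range lam"
        using assms(8) that by (auto simp: bij_betw_def)
      then show ?thesis
        by (auto simp: assms(9) \<nu>_def f_def)
    qed
    then show "\<mu> ` {1..M} \<subseteq> range \<nu>"
      by blast
  qed
  \<comment> \<open>\<open>T\<close> has exactly \<open>M\<close> distinct eigenvalues, so the
    interpolation bound becomes \<open>M - 1\<close>.\<close>
  have card_\<nu>: "card (range \<nu>) = M"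
    unfolding range_\<nu> using assms(10) by (simp add: card_image)
  \<comment> \<open>Inverting \<open>\<mu>\<close> recovers the whole joint eigenvalue from the
    eigenvalue of \<open>T\<close> alone; this is where the choice of the coefficients
    \<open>a\<close> enters.\<close>
  define h where "h y = \<gamma> (the_inv_into {1..M} \<mu> y)" for y
  have f_eq: "f l n = h (\<nu> n) $ l" for l n
    using \<gamma>_index[of n] the_inv_into_f_f[OF assms(10)] by (metis h_def f_def)
  have powers_invariant:
    "shift_invariant S (span {mat_power T k *v \<phi> | k \<phi>. k \<in> {0..M - 1} \<and> \<phi> \<in> \<Phi>})"
    (is "shift_invariant S (span ?G)") for \<Phi>
  proof -
    have "S l *v (mat_power T k *v \<phi>) \<in> span ?G" if "\<phi> \<in> \<Phi>" for l k \<phi>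
    proof -
      \<comment> \<open>The eigenvalues of \<open>S l ** mat_power T k\<close> depend only on those
        of \<open>T\<close>. Interpolating the product, and not just the factor \<open>f l\<close>,
        keeps the degree at most \<open>M - 1\<close> for every \<open>k\<close>.\<close>
      have "f l n * \<nu> n ^ k = h (\<nu> n) $ l * \<nu> n ^ k" for n
        by (simp add: f_eq)
      from spectral_matrix_eq_polynomial[where \<nu> = \<nu> and h = "\<lambda>y. h y $ l * y ^ k", OF Q this]
      obtain c where c: "spectral_matrix Q (\<lambda>n. f l n * \<nu> n ^ k)
          = (\<Sum>j\<in>{0..M - 1}. c j *\<^sub>R mat_power T j)"
        unfolding card_\<nu> T by metis
      have "S l *v (mat_power T k *v \<phi>) = (\<Sum>j\<in>{0..M - 1}. c j *\<^sub>R mat_power T j) *v \<phi>"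
        unfolding c[symmetric]
        by (simp add: T S mat_power_spectral[OF Q] spectral_matrix_mult[OF Q]
            matrix_vector_mul_assoc)
      also have "\<dots> = (\<Sum>j\<in>{0..M - 1}. c j *\<^sub>R (mat_power T j *v \<phi>))"
        by (rule matrix_vector_mult_sum_scaleR)
      also have "\<dots> \<in> span ?G"
        using that by (intro span_sum span_scale span_base) blast
      finally show ?thesis .
    qed
    then have gen: "S l *v b \<in> span ?G" if "b \<in> ?G" for l b
      using that by blast
    have "S l *v x \<in> span ?G" if "x \<in> span ?G" for l x
      using that matrix_vector_mul_linear gen by (rule linear_span_invariant)
    then show ?thesis
      by (simp add: shift_invariant_def)
  qed
  \<comment> \<open>\<open>T\<close> is a linear combination of the shifts, and \<open>U\<close> is
    closed under linear combinations.\<close>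
  have T_invariant: "T *v x \<in> U" if "shift_invariant S U" "x \<in> U" for x
    using that assms(12) unfolding assms(11) matrix_vector_mult_sum_scaleR
    by (intro subspace_sum subspace_scale) (auto simp: shift_invariant_def)
  \<comment> \<open>Both generated forms are compared with shift-invariance; their mutual
    equivalence then follows.\<close>
  have "shift_invariant S U \<longleftrightarrow> (\<exists>\<Phi>. finite \<Phi> \<and> U = generated_space S \<Phi>)"
    (is "_ \<longleftrightarrow> ?generated")
  proof
    assume "shift_invariant S U"
    then show ?generated
      by (rule shift_invariant_imp_generated)
  next
    assume ?generated
    then show "shift_invariant S U"
      using shift_invariant_generated_space[where S = S and f = f, OF Q S]
      by (elim exE conjE) (simp only:)
  qed
  moreover have "shift_invariant S U \<longleftrightarrow>
      (\<exists>\<Phi>. finite \<Phi> \<and> U = span {mat_power T k *v \<phi> | k \<phi>. k \<in> {0..M - 1} \<and> \<phi> \<in> \<Phi>})"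
    (is "_ \<longleftrightarrow> ?powers")
  proof
    assume "shift_invariant S U"
    then show ?powers
      by (intro invariant_imp_generated_powers assms(12) T_invariant)
  next
    assume ?powers
    then show "shift_invariant S U"
      using powers_invariant by (elim exE conjE) (simp only:)
  qed
  ultimately show ?thesis
    by (simp only:)
qed

end
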